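(* Let $K_n$ be the complete graph with $n$ vertices and let $I=J(K_n)$ be its cover ideal. Call $F=x_1x_2\cdots x_n$. Then $$\operatorname{sdefect}(I,m)=\begin{cases} nk+1 & \text{if } m=2k+2,\\ nk & \text{if } m=2k+1,\end{cases}$$ and hence it grows as a linear quasi-polynomial in $m$.
   Context: Let $\mathbb{K}$ be a field. For a graph $G$ with vertex set $\{x_1,\dots,x_n\}$ and edge set $E$, the cover ideal is $J(G)=\bigcap_{\{x_i,x_j\}\in E}(x_i,x_j)\subseteq R=\mathbb{K}[x_1,\dots,x_n]$; its $m$-th symbolic power is $J(G)^{(m)}=\bigcap_{\{x_i,x_j\}\in E}(x_i,x_j)^m$. The complete graph $K_n$ is the graph on $n$ vertices in which every pair of distinct vertices is an edge. For an ideal $I$ and $m\geq 1$, $\operatorname{sdefect}(I,m)=\mu(I^{(m)}/I^m)$ is the minimal number of generators of the $R$-module $I^{(m)}/I^m$. Here $k$ is a nonnegative integer. A quasi-polynomial is a function on $\mathbb{N}$ that agrees with a polynomial with rational coefficients on each residue class modulo some fixed positive integer; it is linear if it has degree one.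
   Formalization: The claim is stated for n ≥ 3; for n = 2 it fails, since I = (x_1,x_2) has I^(m) = I^m and sdefect(I,2) = 0 rather than 1, and for n ≤ 1 there are no edges, so I = R and the symbolic defect is always 0. *)

theory Defs
  imports
    "HOL-Library.Poly_Mapping"
    "HOL-Library.Set_Algebras"
    "HOL-Computational_Algebra.Polynomial"
begin

section \<open>The polynomial ring and its ideals\<close>

text \<open>
  \<open>('v, 'k) mpoly\<close> with \<open>'v\<close> finite is the polynomial ring over \<open>'k\<close> whose variables are
  indexed by \<open>'v\<close>: finitely supported functions from monomials (exponent vectors) to
  coefficients, with the convolution product of \<^theory>\<open>HOL-Library.Poly_Mapping\<close>.
\<close>

type_synonym ('v, 'k) mpoly = "('v \<Rightarrow>\<^sub>0 nat) \<Rightarrow>\<^sub>0 'k"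

definition Var :: "'v \<Rightarrow> ('v, 'k::comm_ring_1) mpoly" where
  "Var v = Poly_Mapping.single (Poly_Mapping.single v 1) 1"

text \<open>The ideal generated by a set is its span in the ring regarded as a module over itself.\<close>

abbreviation ideal_gen :: "'a::comm_ring_1 set \<Rightarrow> 'a set" where
  "ideal_gen \<equiv> module.span (*)"

definition ideal_prod :: "'a::comm_ring_1 set \<Rightarrow> 'a set \<Rightarrow> 'a set" where
  "ideal_prod I J = ideal_gen {a * b | a b. a \<in> I \<and> b \<in> J}"

primrec ideal_pow :: "'a::comm_ring_1 set \<Rightarrow> nat \<Rightarrow> 'a set" where
  "ideal_pow I 0 = UNIV"
| "ideal_pow I (Suc m) = ideal_prod I (ideal_pow I m)"


section \<open>Number of generators of a quotient module\<close>

text \<open>For ideals \<open>N \<subseteq> M\<close>, the underlying set of \<open>M / N\<close> consists of the cosets \<open>x + N\<close> with \<open>x \<in> M\<close>.\<close>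

definition quotient_cosets :: "'a::comm_ring_1 set \<Rightarrow> 'a set \<Rightarrow> 'a set set" where
  "quotient_cosets M N = (\<lambda>x. x +o N) ` M"

text \<open>
  A finite set \<open>S\<close> of cosets generates \<open>M / N\<close> if every coset is an \<open>R\<close>-linear combination of
  \<open>S\<close>.  Here \<open>c *o D\<close> and the sum are the elementwise operations on subsets of the ring; adding
  \<open>N\<close> turns the result into a full coset, since
  \<open>N + (\<Sum>i. c\<^sub>i (d\<^sub>i + N)) = (\<Sum>i. c\<^sub>i d\<^sub>i) + N\<close>.
\<close>

definition generates_quotient ::
    "'a::comm_ring_1 set \<Rightarrow> 'a set \<Rightarrow> 'a set set \<Rightarrow> bool" where
  "generates_quotient M N S \<longleftrightarrow>
     S \<subseteq> quotient_cosets M N \<and>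
     (\<forall>C \<in> quotient_cosets M N. \<exists>c. C = N + (\<Sum>D\<in>S. c D *o D))"

text \<open>
  Only meaningful if \<open>M / N\<close> is finitely generated, which is automatic for ideals of the
  noetherian ring \<open>('v::finite, 'k::field) mpoly\<close>.
\<close>

definition min_gens_quotient :: "'a::comm_ring_1 set \<Rightarrow> 'a set \<Rightarrow> nat" where
  "min_gens_quotient M N = (LEAST r. \<exists>S. finite S \<and> card S = r \<and> generates_quotient M N S)"


section \<open>Cover ideals, symbolic powers, symbolic defect\<close>

text \<open>
  A graph on the vertex set \<open>UNIV :: 'v set\<close> is given by its set of edges, each edge being a
  two-element set of vertices.
\<close>

definition cover_ideal :: "'v::finite set set \<Rightarrow> ('v, 'k::field) mpoly set" where
  "cover_ideal E = (\<Inter>e\<in>E. ideal_gen (Var ` e))"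

definition cover_ideal_sympow :: "'v::finite set set \<Rightarrow> nat \<Rightarrow> ('v, 'k::field) mpoly set" where
  "cover_ideal_sympow E m = (\<Inter>e\<in>E. ideal_pow (ideal_gen (Var ` e)) m)"

text \<open>The type argument determines the coefficient field.\<close>

definition sdefect_cover_ideal :: "'k::field itself \<Rightarrow> 'v::finite set set \<Rightarrow> nat \<Rightarrow> nat" where
  "sdefect_cover_ideal _ E m =
     min_gens_quotient (cover_ideal_sympow E m :: ('v, 'k) mpoly set)
                       (ideal_pow (cover_ideal E) m)"

definition complete_graph :: "'v set set" where
  "complete_graph = {{i, j} | i j. i \<noteq> j}"


section \<open>Quasi-polynomials\<close>

text \<open>
  The symbolic defect is defined for exponents \<open>m \<ge> 1\<close>, so quasi-polynomials are taken as
  functions on the positive integers; the value at \<open>0\<close> is ignored.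
\<close>

definition has_constituents :: "(nat \<Rightarrow> nat) \<Rightarrow> nat \<Rightarrow> (nat \<Rightarrow> rat poly) \<Rightarrow> bool" where
  "has_constituents f d p \<longleftrightarrow>
     d > 0 \<and> (\<forall>m\<ge>1. of_nat (f m) = poly (p (m mod d)) (of_nat m))"

text \<open>The degree of a quasi-polynomial is the largest degree of its constituents.\<close>

definition linear_quasi_polynomial :: "(nat \<Rightarrow> nat) \<Rightarrow> bool" where
  "linear_quasi_polynomial f \<longleftrightarrow>
     (\<exists>d p. has_constituents f d p \<and> Max ((\<lambda>i. degree (p i)) ` {..<d}) = 1)"

end

theory Submission
  imports Defs "HOL-Library.Function_Algebras"
begin

text \<open>
  Everything in sight is a monomial ideal, so the computation takes place among exponent vectors.
  Write \<open>x\<^sup>a\<close> for the monomial with exponent vector \<open>a\<close>, and identify a monomial ideal with the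
  set of exponents of its monomials; products of ideals become Minkowski sums and intersections
  become intersections (\<open>ideal_prod_monom_ideal\<close>, \<open>ideal_pow_monom_ideal\<close>).  In these terms
  \<open>I\<^sup>(\<^sup>m\<^sup>)\<close> consists of the \<open>a\<close> with \<open>a\<^sub>i + a\<^sub>j \<ge> m\<close> for all \<open>i \<noteq> j\<close>.  In such an \<open>a\<close>, a smallest
  coordinate \<open>a\<^sub>i\<close> determines how small the others can be: the minimal elements are the vectors
  with one entry \<open>t \<le> m/2\<close> and all others \<open>m - t\<close>, which are the exponents of
  \<open>F\<^sup>t (F/x\<^sub>i)\<^sup>m\<^sup>-\<^sup>2\<^sup>t\<close>.

  For \<open>t = 0\<close> this is a power of the generator \<open>F/x\<^sub>i\<close> of \<open>I\<close>, so it lies in \<open>I\<^sup>m\<close>.  For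
  \<open>t \<ge> 1\<close> its degree is \<open>m(n-1) - t(n-2)\<close>, less than the degree \<open>m(n-1)\<close> of the generators of
  \<open>I\<^sup>m\<close> because \<open>n \<ge> 3\<close>, so it does not lie in \<open>I\<^sup>m\<close>
  (\<open>degree_nfold_cover_sum_ge\<close>).  By the graded Nakayama lemma, in the monomial form
  \<open>min_gens_quotient_monom_ideal\<close>, the symbolic defect is the number of vectors with
  \<open>1 \<le> t \<le> m/2\<close>.  There are \<open>n\<close> of them for every \<open>t < m/2\<close>, and all \<open>n\<close> choices of \<open>i\<close>
  coincide (giving a power of \<open>F\<close>) for \<open>t = m/2\<close>.
\<close>

section \<open>Cosets in quotients of ideals\<close>

interpretation ring_mod: module "(*) :: 'a::comm_ring_1 \<Rightarrow> 'a \<Rightarrow> 'a"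
  by unfold_locales (simp_all add: algebra_simps)

text \<open>For a ring acting on itself this rule makes \<open>algebra_simps\<close> loop: it reverses \<open>mult.assoc\<close>.\<close>

declare ring_mod.scale_scale [simp del]

lemma scaled_coset_plus_coset:
  fixes N :: "'a::comm_ring_1 set"
  assumes "ring_mod.subspace N"
  shows "c *o (x +o N) + (y +o N) = (c * x + y) +o N"
proof (intro equalityI subsetI)
  fix z assume "z \<in> c *o (x +o N) + (y +o N)"
  then obtain u v where uv: "u \<in> N" "v \<in> N" "z = c * (x + u) + (y + v)"
    by (auto simp: elt_set_times_def elt_set_plus_def set_plus_def)
  have "c * u + v \<in> N"
    using assms uv ring_mod.subspace_add ring_mod.subspace_scale by blast
  moreover have "z = (c * x + y) + (c * u + v)"
    by (simp add: uv algebra_simps)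
  ultimately show "z \<in> (c * x + y) +o N" by (auto simp: elt_set_plus_def)
next
  fix z assume "z \<in> (c * x + y) +o N"
  then obtain v where v: "v \<in> N" "z = (c * x + y) + v" by (auto simp: elt_set_plus_def)
  have "0 \<in> N" using assms by (rule ring_mod.subspace_0)
  then have "c * (x + 0) \<in> c *o (x +o N)" "y + v \<in> y +o N"
    using v by (auto simp: elt_set_times_def elt_set_plus_def)
  then have "c * (x + 0) + (y + v) \<in> c *o (x +o N) + (y +o N)" by (rule set_plus_intro)
  then show "z \<in> c *o (x +o N) + (y +o N)" by (simp add: v algebra_simps)
qed

text \<open>
  This turns the elementwise linear combinations in the definition of a generating set of cosets
  into combinations of representatives.
\<close>

lemma coset_linear_combination:
  fixes N :: "'a::comm_ring_1 set"
  assumes "ring_mod.subspace N" and "finite B"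
  shows "N + (\<Sum>b\<in>B. c b *o (x b +o N)) = (\<Sum>b\<in>B. c b * x b) +o N"
  using assms(2)
proof (induction B rule: finite_induct)
  case empty
  then show ?case by (auto simp: elt_set_plus_def)
next
  case (insert b B)
  have "N + (\<Sum>b\<in>insert b B. c b *o (x b +o N))
      = c b *o (x b +o N) + (N + (\<Sum>b\<in>B. c b *o (x b +o N)))"
    using insert.hyps by (simp add: add.left_commute)
  then show ?case
    using insert by (simp add: scaled_coset_plus_coset[OF assms(1)])
qed

lemma coset_eq_iff:
  fixes N :: "'a::comm_ring_1 set"
  assumes "ring_mod.subspace N"
  shows "x +o N = y +o N \<longleftrightarrow> x - y \<in> N"
proof
  assume "x +o N = y +o N"
  moreover have "x \<in> x +o N"
    using ring_mod.subspace_0[OF assms] by (force simp: elt_set_plus_def)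
  ultimately show "x - y \<in> N" by (simp add: set_plus_imp_minus)
next
  assume d: "x - y \<in> N"
  show "x +o N = y +o N"
  proof (intro equalityI subsetI)
    fix z assume "z \<in> x +o N"
    then have "(z - x) + (x - y) \<in> N"
      using d ring_mod.subspace_add[OF assms] by (blast dest: set_plus_imp_minus)
    then show "z \<in> y +o N" by (intro set_minus_imp_plus) simp
  next
    fix z assume "z \<in> y +o N"
    then have "(z - y) - (x - y) \<in> N"
      using d ring_mod.subspace_diff[OF assms] by (blast dest: set_plus_imp_minus)
    then show "z \<in> x +o N" by (intro set_minus_imp_plus) simp
  qed
qed

text \<open>
  The hypothesis factors the identity matrix indexed by \<open>B\<close> through a space of dimension
  \<open>card S\<close>, which forces \<open>card B \<le> card S\<close>.
\<close>

lemma card_le_of_identity_factorization: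
  fixes c :: "'a \<Rightarrow> 's \<Rightarrow> 'k::field" and \<phi> :: "'s \<Rightarrow> 'a \<Rightarrow> 'k"
  assumes "finite S"
    and fact: "\<And>b b'. b \<in> B \<Longrightarrow> b' \<in> B \<Longrightarrow>
      (\<Sum>D\<in>S. c b D * \<phi> D b') = (if b' = b then 1 else 0)"
  shows "card B \<le> card S"
proof -
  interpret V: vector_space "\<lambda>(r::'k) (f::'a \<Rightarrow> 'k) x. r * f x"
    by unfold_locales (auto simp: fun_eq_iff distrib_left distrib_right)
  define \<delta> :: "'a \<Rightarrow> 'a \<Rightarrow> 'k" where "\<delta> = (\<lambda>b x. if x = b then 1 else 0)"
  define \<psi> where "\<psi> = (\<lambda>D x. if x \<in> B then \<phi> D x else 0)"
  have inj: "inj_on \<delta> B"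
  proof (rule inj_onI)
    fix b b' assume "\<delta> b = \<delta> b'"
    then have "\<delta> b b = \<delta> b' b" by (rule fun_cong)
    then show "b = b'" by (simp add: \<delta>_def split: if_splits)
  qed
  have indep: "V.independent (\<delta> ` B)"
    unfolding V.dependent_def
  proof
    assume "\<exists>a\<in>\<delta> ` B. a \<in> V.span (\<delta> ` B - {a})"
    then obtain b where b: "b \<in> B" "\<delta> b \<in> V.span (\<delta> ` B - {\<delta> b})" by blast
    have "V.span (\<delta> ` B - {\<delta> b}) \<subseteq> {f. f b = 0}"
    proof (rule V.span_minimal)
      show "\<delta> ` B - {\<delta> b} \<subseteq> {f. f b = 0}" by (auto simp: \<delta>_def)
      show "V.subspace {f. f b = 0}" by (auto simp: V.subspace_def)
    qed
    then have "\<delta> b b = 0" using b by blast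
    then show False by (simp add: \<delta>_def)
  qed
  have "\<delta> ` B \<subseteq> V.span (\<psi> ` S)"
  proof
    fix f assume "f \<in> \<delta> ` B"
    then obtain b where b: "b \<in> B" "f = \<delta> b" by blast
    have "f = (\<Sum>D\<in>S. (\<lambda>x. c b D * \<psi> D x))"
    proof
      fix x
      have "(\<Sum>D\<in>S. (\<lambda>x. c b D * \<psi> D x)) x = (\<Sum>D\<in>S. c b D * \<psi> D x)"
        by (induction S rule: infinite_finite_induct) auto
      then show "f x = (\<Sum>D\<in>S. (\<lambda>x. c b D * \<psi> D x)) x"
        using b fact[of b x] by (cases "x \<in> B") (auto simp: \<delta>_def \<psi>_def)
    qed
    then show "f \<in> V.span (\<psi> ` S)"
      by (simp add: V.span_sum V.span_scale V.span_base)
  qed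
  then have "card (\<delta> ` B) \<le> card (\<psi> ` S)"
    using V.independent_span_bound[OF _ indep] \<open>finite S\<close> by blast
  then show ?thesis
    using card_image[OF inj] card_image_le[OF \<open>finite S\<close>, of \<psi>] by linarith
qed


section \<open>Monomial ideals\<close>

definition monomial :: "('v \<Rightarrow>\<^sub>0 nat) \<Rightarrow> ('v, 'k::comm_ring_1) mpoly" where
  "monomial a = Poly_Mapping.single a 1"

definition monom_ideal :: "('v \<Rightarrow>\<^sub>0 nat) set \<Rightarrow> ('v, 'k::comm_ring_1) mpoly set" where
  "monom_ideal A = {f. Poly_Mapping.keys f \<subseteq> A}"

text \<open>These are the sets \<open>A\<close> for which \<open>monom_ideal A\<close> is an ideal.\<close>

definition up_closed :: "('v \<Rightarrow>\<^sub>0 nat) set \<Rightarrow> bool" where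
  "up_closed A \<longleftrightarrow> (\<forall>a\<in>A. \<forall>e. e + a \<in> A)"

lemma up_closedD: "up_closed A \<Longrightarrow> a \<in> A \<Longrightarrow> e + a \<in> A"
  by (auto simp: up_closed_def)

lemma up_closed_set_plus:
  assumes "up_closed A"
  shows "up_closed (A + B)"
  unfolding up_closed_def
proof (intro ballI allI)
  fix x e assume "x \<in> A + B"
  then obtain a b where ab: "x = a + b" "a \<in> A" "b \<in> B" by (rule set_plus_elim)
  then have "(e + a) + b \<in> A + B" using up_closedD[OF assms] by (intro set_plus_intro)
  then show "e + x \<in> A + B" by (simp add: ab add.assoc)
qed

lemma monomial_in_monom_ideal [simp]:
  "(monomial a :: ('v, 'k::comm_ring_1) mpoly) \<in> monom_ideal A \<longleftrightarrow> a \<in> A"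
  by (simp add: monomial_def monom_ideal_def)

lemma single_eq_monomial_multiple:
  "Poly_Mapping.single (e + a) (r::'k::comm_ring_1) = Poly_Mapping.single e r * monomial a"
  by (simp add: monomial_def mult_single)

lemma sum_single_lookup:
  "(\<Sum>a\<in>Poly_Mapping.keys f. Poly_Mapping.single a (Poly_Mapping.lookup f a)) = f"
  by (rule poly_mapping_eqI)
    (auto simp: lookup_sum lookup_single when_def in_keys_iff)

lemma monom_ideal_subspace:
  assumes "up_closed A"
  shows "ring_mod.subspace (monom_ideal A :: ('v, 'k::comm_ring_1) mpoly set)"
  unfolding ring_mod.subspace_def
proof (intro conjI ballI allI)
  show "0 \<in> monom_ideal A" by (simp add: monom_ideal_def)
next
  fix f g :: "('v, 'k) mpoly" assume "f \<in> monom_ideal A" "g \<in> monom_ideal A"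
  then show "f + g \<in> monom_ideal A"
    using Poly_Mapping.keys_add[of f g] by (auto simp: monom_ideal_def)
next
  fix c f :: "('v, 'k) mpoly" assume "f \<in> monom_ideal A"
  then show "c * f \<in> monom_ideal A"
    using keys_mult[of c f] up_closedD[OF assms] by (fastforce simp: monom_ideal_def)
qed

text \<open>A polynomial is the sum of its terms, so an inclusion need only be checked on terms.\<close>

lemma monom_ideal_subset_subspace:
  fixes N :: "('v, 'k::comm_ring_1) mpoly set"
  assumes "ring_mod.subspace N"
    and "\<And>a r. a \<in> A \<Longrightarrow> Poly_Mapping.single a r \<in> N"
  shows "monom_ideal A \<subseteq> N"
proof
  fix f :: "('v, 'k) mpoly" assume "f \<in> monom_ideal A"
  then have "(\<Sum>a\<in>Poly_Mapping.keys f. Poly_Mapping.single a (Poly_Mapping.lookup f a)) \<in> N"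
    by (intro ring_mod.subspace_sum assms) (auto simp: monom_ideal_def)
  then show "f \<in> N" by (simp add: sum_single_lookup)
qed

lemma ideal_gen_monomials:
  "(ideal_gen (monomial ` G) :: ('v, 'k::comm_ring_1) mpoly set) = monom_ideal (UNIV + G)"
proof (rule antisym)
  have up: "up_closed (UNIV + G)"
    by (rule up_closed_set_plus) (simp add: up_closed_def)
  have "g \<in> UNIV + G" if "g \<in> G" for g
    using set_plus_intro[of 0 UNIV g G] that by simp
  then show "(ideal_gen (monomial ` G) :: ('v, 'k) mpoly set) \<subseteq> monom_ideal (UNIV + G)"
    by (intro ring_mod.span_minimal monom_ideal_subspace up) auto
  show "(monom_ideal (UNIV + G) :: ('v, 'k) mpoly set) \<subseteq> ideal_gen (monomial ` G)"
    by (rule monom_ideal_subset_subspace)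
      (auto simp: single_eq_monomial_multiple ring_mod.span_scale ring_mod.span_base
        elim!: set_plus_elim)
qed

lemma ideal_prod_monom_ideal:
  assumes "up_closed A"
  shows "(ideal_prod (monom_ideal A) (monom_ideal B) :: ('v, 'k::comm_ring_1) mpoly set)
    = monom_ideal (A + B)"
  unfolding ideal_prod_def
proof (rule antisym)
  let ?P = "{f * g | f g :: ('v, 'k) mpoly. f \<in> monom_ideal A \<and> g \<in> monom_ideal B}"
  have "f * g \<in> monom_ideal (A + B)" if "f \<in> monom_ideal A" "g \<in> monom_ideal B"
    for f g :: "('v, 'k) mpoly"
    using that keys_mult[of f g] by (fastforce simp: monom_ideal_def)
  then show "ideal_gen ?P \<subseteq> monom_ideal (A + B)"
    by (intro ring_mod.span_minimal monom_ideal_subspace up_closed_set_plus assms) auto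
  show "monom_ideal (A + B) \<subseteq> ideal_gen ?P"
  proof (rule monom_ideal_subset_subspace)
    fix a and r :: 'k assume "a \<in> A + B"
    then obtain u v where uv: "a = u + v" "u \<in> A" "v \<in> B" by (rule set_plus_elim)
    then have "Poly_Mapping.single u r \<in> monom_ideal A" "(monomial v :: ('v, 'k) mpoly) \<in> monom_ideal B"
      by (auto simp: monom_ideal_def monomial_def)
    then have "Poly_Mapping.single u r * monomial v \<in> ?P" by blast
    then show "Poly_Mapping.single a r \<in> ideal_gen ?P"
      unfolding uv single_eq_monomial_multiple by (rule ring_mod.span_base)
  qed simp
qed

text \<open>The empty sum is the set of all exponents rather than \<open>{0}\<close>, because \<open>I\<^sup>0\<close> is the whole ring.\<close>

primrec nfold_sum :: "('v \<Rightarrow>\<^sub>0 nat) set \<Rightarrow> nat \<Rightarrow> ('v \<Rightarrow>\<^sub>0 nat) set" where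
  "nfold_sum A 0 = UNIV"
| "nfold_sum A (Suc m) = A + nfold_sum A m"

lemma up_closed_nfold_sum: "up_closed A \<Longrightarrow> up_closed (nfold_sum A m)"
  by (cases m) (simp_all add: up_closed_set_plus, simp add: up_closed_def)

lemma ideal_pow_monom_ideal:
  assumes "up_closed A"
  shows "ideal_pow (monom_ideal A :: ('v, 'k::comm_ring_1) mpoly set) m
    = monom_ideal (nfold_sum A m)"
proof (induction m)
  case 0
  show ?case by (auto simp: monom_ideal_def)
next
  case (Suc m)
  then show ?case by (simp add: ideal_prod_monom_ideal[OF assms])
qed

text \<open>
  A term of \<open>c * f\<close> at a minimal exponent \<open>b\<close> can only come from the constant term of \<open>c\<close>.
\<close>

lemma lookup_mult_at_minimal:
  fixes c f :: "('v, 'k::comm_ring_1) mpoly"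
  assumes f: "f \<in> monom_ideal A" and min: "\<And>e a. a \<in> A \<Longrightarrow> b = e + a \<Longrightarrow> e = 0"
  shows "Poly_Mapping.lookup (c * f) b = Poly_Mapping.lookup c 0 * Poly_Mapping.lookup f b"
proof -
  define c0 where "c0 = Poly_Mapping.single (0 :: 'v \<Rightarrow>\<^sub>0 nat) (Poly_Mapping.lookup c 0)"
  have "b \<notin> Poly_Mapping.keys ((c - c0) * f)"
  proof
    assume "b \<in> Poly_Mapping.keys ((c - c0) * f)"
    then obtain e a where ea: "b = e + a" "e \<in> Poly_Mapping.keys (c - c0)" "a \<in> Poly_Mapping.keys f"
      using keys_mult[of "c - c0" f] by blast
    then have "e = 0" using min f by (auto simp: monom_ideal_def)
    then show False using ea by (simp add: c0_def in_keys_iff lookup_minus)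
  qed
  then have "Poly_Mapping.lookup ((c - c0) * f) b = 0" by (simp add: in_keys_iff)
  moreover have "c * f = c0 * f + (c - c0) * f" by (simp add: algebra_simps)
  moreover have "Poly_Mapping.lookup (c0 * f) b = Poly_Mapping.lookup c 0 * Poly_Mapping.lookup f b"
    unfolding c0_def mult_map_scale_conv_mult[symmetric]
    by (simp add: Poly_Mapping.map.rep_eq when_def)
  ultimately show ?thesis by (simp add: lookup_add)
qed

text \<open>
  Nakayama's lemma for a quotient \<open>M/N\<close> of monomial ideals, where \<open>B\<close> is the set of minimal
  exponents of \<open>M\<close> outside \<open>N\<close>.  The cosets of the monomials in \<open>B\<close> generate.  Conversely, the
  coefficients at the exponents in \<open>B\<close> are functionals on \<open>M\<close> that vanish on \<open>N\<close> and see a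
  multiplier only through its constant term; applied to expressions of the monomials in \<open>B\<close> by a
  generating set, they factor an identity matrix, so that no generating set is smaller.
\<close>

theorem min_gens_quotient_monom_ideal:
  fixes A D B :: "('v \<Rightarrow>\<^sub>0 nat) set"
  assumes A: "up_closed A" and D: "up_closed D"
    and B: "finite B" "B \<subseteq> A" "B \<inter> D = {}"
    and cover: "\<And>a. a \<in> A \<Longrightarrow> a \<notin> D \<Longrightarrow> \<exists>e. \<exists>b\<in>B. a = e + b"
    and min: "\<And>b e a. b \<in> B \<Longrightarrow> a \<in> A \<Longrightarrow> b = e + a \<Longrightarrow> e = 0"
  shows "min_gens_quotient (monom_ideal A :: ('v, 'k::field) mpoly set) (monom_ideal D) = card B"
proof -
  let ?M = "monom_ideal A :: ('v, 'k) mpoly set" and ?N = "monom_ideal D :: ('v, 'k) mpoly set"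
  define X where "X = (\<lambda>b. monomial b :: ('v, 'k) mpoly)"
  define h where "h = (\<lambda>b. X b +o ?N)"
  note N = monom_ideal_subspace[OF D, where 'k = 'k]
  have inj: "inj_on h B"
  proof (rule inj_onI, rule ccontr)
    fix b b' assume *: "b \<in> B" "b' \<in> B" "h b = h b'" "b \<noteq> b'"
    then have "X b - X b' \<in> ?N" by (simp add: h_def coset_eq_iff[OF N])
    moreover have "b \<in> Poly_Mapping.keys (X b - X b')"
      using * by (simp add: X_def monomial_def in_keys_iff lookup_minus lookup_single)
    ultimately show False using * B by (auto simp: monom_ideal_def)
  qed
  have decomp: "\<exists>c. f - (\<Sum>b\<in>B. c b * X b) \<in> ?N" if f: "f \<in> ?M" for f
  proof -
    define Q where "Q = {f. \<exists>c. f - (\<Sum>b\<in>B. c b * X b) \<in> ?N}"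
    have "ring_mod.subspace Q"
      unfolding ring_mod.subspace_def
    proof (intro conjI ballI allI)
      show "0 \<in> Q"
        unfolding Q_def using ring_mod.subspace_0[OF N] by (auto intro!: exI[of _ "\<lambda>_. 0"])
    next
      fix f g assume "f \<in> Q" "g \<in> Q"
      then obtain c d where
        "f - (\<Sum>b\<in>B. c b * X b) \<in> ?N" "g - (\<Sum>b\<in>B. d b * X b) \<in> ?N"
        by (auto simp: Q_def)
      then have "(f - (\<Sum>b\<in>B. c b * X b)) + (g - (\<Sum>b\<in>B. d b * X b)) \<in> ?N"
        by (rule ring_mod.subspace_add[OF N])
      then have "(f + g) - (\<Sum>b\<in>B. (c b + d b) * X b) \<in> ?N"
        by (simp add: algebra_simps sum.distrib)
      then show "f + g \<in> Q" unfolding Q_def by (intro CollectI exI)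
    next
      fix r f assume "f \<in> Q"
      then obtain c where "f - (\<Sum>b\<in>B. c b * X b) \<in> ?N" by (auto simp: Q_def)
      then have "r * (f - (\<Sum>b\<in>B. c b * X b)) \<in> ?N" by (rule ring_mod.subspace_scale[OF N])
      then have "r * f - (\<Sum>b\<in>B. (r * c b) * X b) \<in> ?N"
        by (simp only: right_diff_distrib sum_distrib_left mult.assoc)
      then show "r * f \<in> Q" unfolding Q_def by (intro CollectI exI)
    qed
    moreover have "Poly_Mapping.single a r \<in> Q" if a: "a \<in> A" for a r
    proof (cases "a \<in> D")
      case True
      then have "Poly_Mapping.single a r \<in> ?N" by (simp add: monom_ideal_def)
      then show ?thesis unfolding Q_def by (auto intro!: exI[of _ "\<lambda>_. 0"])
    next
      case False
      then obtain e b where eb: "b \<in> B" "a = e + b" using cover a by blast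
      have "(\<Sum>b'\<in>B. (if b' = b then Poly_Mapping.single e r else 0) * X b')
          = (\<Sum>b'\<in>B. if b' = b then Poly_Mapping.single e r * X b' else 0)"
        by (rule sum.cong) auto
      also have "\<dots> = Poly_Mapping.single a r"
        using eb B by (simp add: X_def single_eq_monomial_multiple)
      finally show ?thesis
        unfolding Q_def using ring_mod.subspace_0[OF N]
        by (auto intro!: exI[of _ "\<lambda>b'. if b' = b then Poly_Mapping.single e r else 0"])
    qed
    ultimately have "?M \<subseteq> Q" by (rule monom_ideal_subset_subspace)
    then show ?thesis using f by (auto simp: Q_def)
  qed
  have gen: "generates_quotient ?M ?N (h ` B)"
    unfolding generates_quotient_def
  proof (intro conjI ballI)
    show "h ` B \<subseteq> quotient_cosets ?M ?N"
      using B by (auto simp: h_def X_def quotient_cosets_def)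
    fix C assume "C \<in> quotient_cosets ?M ?N"
    then obtain f where f: "f \<in> ?M" "C = f +o ?N" by (auto simp: quotient_cosets_def)
    then obtain c where "f - (\<Sum>b\<in>B. c b * X b) \<in> ?N" using decomp by blast
    then have "C = (\<Sum>b\<in>B. c b * X b) +o ?N" by (simp add: f coset_eq_iff[OF N])
    also have "\<dots> = ?N + (\<Sum>b\<in>B. c b *o h b)"
      by (simp add: h_def coset_linear_combination[OF N B(1)])
    also have "(\<Sum>b\<in>B. c b *o h b) = (\<Sum>E\<in>h ` B. c (the_inv_into B h E) *o E)"
      by (simp add: sum.reindex[OF inj] the_inv_into_f_f[OF inj])
    finally show "\<exists>c. C = ?N + (\<Sum>E\<in>h ` B. c E *o E)"
      by (intro exI)
  qed
  have lower: "card B \<le> card S" if S: "finite S" "generates_quotient ?M ?N S" for S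
  proof -
    have "\<forall>E\<in>S. \<exists>f. f \<in> ?M \<and> E = f +o ?N"
      using S by (auto simp: generates_quotient_def quotient_cosets_def)
    then obtain rep where rep: "\<And>E. E \<in> S \<Longrightarrow> rep E \<in> ?M" "\<And>E. E \<in> S \<Longrightarrow> E = rep E +o ?N"
      by metis
    have "\<exists>c. X b - (\<Sum>E\<in>S. c E * rep E) \<in> ?N" if "b \<in> B" for b
    proof -
      have "X b +o ?N \<in> quotient_cosets ?M ?N"
        using that B by (auto simp: quotient_cosets_def X_def)
      then obtain c where c: "X b +o ?N = ?N + (\<Sum>E\<in>S. c E *o E)"
        using S by (auto simp: generates_quotient_def)
      have "(\<Sum>E\<in>S. c E *o E) = (\<Sum>E\<in>S. c E *o (rep E +o ?N))"
        using rep(2) by (intro sum.cong) auto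
      then have "X b +o ?N = (\<Sum>E\<in>S. c E * rep E) +o ?N"
        using c coset_linear_combination[OF N S(1)] by simp
      then show ?thesis using coset_eq_iff[OF N] by blast
    qed
    then obtain c where c: "\<And>b. b \<in> B \<Longrightarrow> X b - (\<Sum>E\<in>S. c b E * rep E) \<in> ?N"
      by metis
    show ?thesis
    proof (rule card_le_of_identity_factorization[OF S(1)])
      fix b b' assume b: "b \<in> B" "b' \<in> B"
      have "b' \<notin> D" using b B by blast
      then have "Poly_Mapping.lookup (X b - (\<Sum>E\<in>S. c b E * rep E)) b' = 0"
        using c[OF b(1)] by (auto simp: monom_ideal_def in_keys_iff)
      then have "Poly_Mapping.lookup (X b) b' = (\<Sum>E\<in>S. Poly_Mapping.lookup (c b E * rep E) b')"
        by (simp add: lookup_minus lookup_sum)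
      also have "\<dots> = (\<Sum>E\<in>S. Poly_Mapping.lookup (c b E) 0 * Poly_Mapping.lookup (rep E) b')"
        using rep(1) min[OF b(2)] by (intro sum.cong refl lookup_mult_at_minimal) auto
      finally show "(\<Sum>E\<in>S. Poly_Mapping.lookup (c b E) 0 * Poly_Mapping.lookup (rep E) b')
          = (if b' = b then 1 else 0)"
        by (auto simp: X_def monomial_def lookup_single when_def split: if_splits)
    qed
  qed
  show ?thesis
    unfolding min_gens_quotient_def
  proof (rule Least_equality)
    show "\<exists>S. finite S \<and> card S = card B \<and> generates_quotient ?M ?N S"
      using gen B(1) card_image[OF inj] by blast
  qed (use lower in blast)
qed


section \<open>Exponents of the cover ideal of a complete graph\<close>

definition expvec :: "('v::finite \<Rightarrow> nat) \<Rightarrow> ('v \<Rightarrow>\<^sub>0 nat)" where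
  "expvec f = Abs_poly_mapping f"

lemma lookup_expvec [simp]: "Poly_Mapping.lookup (expvec f) = f"
  by (simp add: expvec_def)

text \<open>
  For \<open>i \<noteq> j\<close> the first set consists of the exponents of \<open>(x\<^sub>i, x\<^sub>j)\<^sup>m\<close>; the second one of the exponents
  of the symbolic power \<open>I\<^sup>(\<^sup>m\<^sup>)\<close>.
\<close>

definition edge_exps :: "'v \<Rightarrow> 'v \<Rightarrow> nat \<Rightarrow> ('v \<Rightarrow>\<^sub>0 nat) set" where
  "edge_exps i j m = {a. m \<le> Poly_Mapping.lookup a i + Poly_Mapping.lookup a j}"

definition cover_exps :: "nat \<Rightarrow> ('v \<Rightarrow>\<^sub>0 nat) set" where
  "cover_exps m = {a. \<forall>i j. i \<noteq> j \<longrightarrow> m \<le> Poly_Mapping.lookup a i + Poly_Mapping.lookup a j}"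

lemma up_closed_edge_exps: "up_closed (edge_exps i j m)"
  by (auto simp: up_closed_def edge_exps_def lookup_add)

lemma up_closed_cover_exps: "up_closed (cover_exps m)"
  by (force simp: up_closed_def cover_exps_def lookup_add intro: trans_le_add2)

lemma le_exponent_imp_add:
  fixes a b :: "'v \<Rightarrow>\<^sub>0 nat"
  assumes "\<And>v. Poly_Mapping.lookup b v \<le> Poly_Mapping.lookup a v"
  shows "a = (a - b) + b"
  using assms by (intro poly_mapping_eqI) (simp add: lookup_add lookup_minus)

lemma exponent_eq_single_plus:
  fixes a :: "'v \<Rightarrow>\<^sub>0 nat"
  assumes "1 \<le> Poly_Mapping.lookup a v"
  shows "a = Poly_Mapping.single v 1 + (a - Poly_Mapping.single v 1)"
proof -
  have "a = (a - Poly_Mapping.single v 1) + Poly_Mapping.single v 1"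
    using assms by (intro le_exponent_imp_add) (auto simp: lookup_single when_def)
  then show ?thesis by (simp only: add.commute)
qed

lemma edge_ideal:
  "(ideal_gen (Var ` {i, j}) :: ('v, 'k::comm_ring_1) mpoly set) = monom_ideal (edge_exps i j 1)"
proof -
  define G where "G = {Poly_Mapping.single i (1::nat), Poly_Mapping.single j 1}"
  have "Var ` {i, j} = (monomial ` G :: ('v, 'k) mpoly set)"
    by (auto simp: G_def Var_def monomial_def)
  moreover have "UNIV + G = edge_exps i j 1"
  proof (intro equalityI subsetI)
    fix a assume "a \<in> UNIV + G"
    then show "a \<in> edge_exps i j 1"
      by (auto simp: G_def edge_exps_def lookup_add lookup_single elim!: set_plus_elim)
  next
    fix a assume "a \<in> edge_exps i j 1"
    then have "1 \<le> Poly_Mapping.lookup a i \<or> 1 \<le> Poly_Mapping.lookup a j"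
      by (auto simp: edge_exps_def)
    then obtain v where v: "v = i \<or> v = j" "1 \<le> Poly_Mapping.lookup a v" by blast
    then have "a = (a - Poly_Mapping.single v 1) + Poly_Mapping.single v 1"
      using exponent_eq_single_plus[OF v(2)] by (simp only: add.commute)
    then show "a \<in> UNIV + G"
      using v set_plus_intro[of "a - Poly_Mapping.single v 1" UNIV "Poly_Mapping.single v 1" G]
      by (auto simp: G_def)
  qed
  ultimately show ?thesis by (simp only: ideal_gen_monomials)
qed

lemma nfold_sum_edge_exps:
  assumes "i \<noteq> j"
  shows "nfold_sum (edge_exps i j 1) m = edge_exps i j m"
proof (induction m)
  case 0
  show ?case by (simp add: edge_exps_def)
next
  case (Suc m)
  have "edge_exps i j 1 + edge_exps i j m = edge_exps i j (Suc m)"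
  proof (intro equalityI subsetI)
    fix a assume "a \<in> edge_exps i j 1 + edge_exps i j m"
    then show "a \<in> edge_exps i j (Suc m)"
      by (auto simp: edge_exps_def lookup_add elim!: set_plus_elim)
  next
    fix a assume a: "a \<in> edge_exps i j (Suc m)"
    then have "1 \<le> Poly_Mapping.lookup a i \<or> 1 \<le> Poly_Mapping.lookup a j"
      by (auto simp: edge_exps_def)
    then obtain v where v: "v = i \<or> v = j" "1 \<le> Poly_Mapping.lookup a v" by blast
    let ?s = "Poly_Mapping.single v (1::nat)"
    have "a = ?s + (a - ?s)"
      using v(2) by (rule exponent_eq_single_plus)
    moreover have "?s \<in> edge_exps i j 1" "a - ?s \<in> edge_exps i j m"
      using v a assms by (auto simp: edge_exps_def lookup_single lookup_minus when_def)
    ultimately show "a \<in> edge_exps i j 1 + edge_exps i j m" by (metis set_plus_intro)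
  qed
  then show ?case using Suc by simp
qed

lemma Inter_complete_graph:
  fixes f :: "'v set \<Rightarrow> 'a set"
  shows "(\<Inter>e\<in>complete_graph. f e) = (\<Inter>(i, j)\<in>{(i, j). i \<noteq> j}. f {i, j})"
proof -
  have eq: "(complete_graph :: 'v set set) = (\<lambda>(i, j). {i, j}) ` {(i, j). i \<noteq> j}"
    unfolding complete_graph_def by (rule set_eqI) (auto simp: image_iff)
  show ?thesis unfolding eq image_image by (simp add: case_prod_beta)
qed

lemma cover_ideal_sympow_complete_graph:
  "(cover_ideal_sympow complete_graph m :: ('v::finite, 'k::field) mpoly set)
    = monom_ideal (cover_exps m)"
proof -
  have "cover_ideal_sympow complete_graph m
      = (\<Inter>(i, j)\<in>{(i, j). i \<noteq> j}. ideal_pow (ideal_gen (Var ` {i, j})) m :: ('v, 'k) mpoly set)"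
    by (simp only: cover_ideal_sympow_def Inter_complete_graph)
  also have "\<dots> = (\<Inter>(i, j)\<in>{(i, j). i \<noteq> j}. monom_ideal (edge_exps i j m))"
    by (intro INF_cong refl)
      (auto simp: ideal_pow_monom_ideal[OF up_closed_edge_exps] nfold_sum_edge_exps edge_ideal
        simp del: image_insert One_nat_def)
  also have "\<dots> = monom_ideal (cover_exps m)"
    by (auto simp: monom_ideal_def edge_exps_def cover_exps_def)
  finally show ?thesis .
qed

lemma cover_ideal_complete_graph:
  "(cover_ideal complete_graph :: ('v::finite, 'k::field) mpoly set) = monom_ideal (cover_exps 1)"
proof -
  have "cover_ideal complete_graph
      = (\<Inter>(i, j)\<in>{(i, j). i \<noteq> j}. ideal_gen (Var ` {i, j}) :: ('v, 'k) mpoly set)"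
    by (simp only: cover_ideal_def Inter_complete_graph)
  also have "\<dots> = (\<Inter>(i, j)\<in>{(i, j). i \<noteq> j}. monom_ideal (edge_exps i j 1))"
    by (simp only: edge_ideal)
  also have "\<dots> = monom_ideal (cover_exps 1)"
    by (auto simp: monom_ideal_def edge_exps_def cover_exps_def)
  finally show ?thesis .
qed

text \<open>
  A vertex cover of \<open>K\<^sub>n\<close> misses at most one vertex, so each summand has at most one zero entry and
  hence degree at least \<open>n - 1\<close>.
\<close>

lemma degree_nfold_cover_sum_ge:
  fixes a :: "'v::finite \<Rightarrow>\<^sub>0 nat"
  assumes "a \<in> nfold_sum (cover_exps 1) m"
  shows "m * (card (UNIV :: 'v set) - 1) \<le> (\<Sum>v\<in>UNIV. Poly_Mapping.lookup a v)"
  using assms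
proof (induction m arbitrary: a)
  case 0
  then show ?case by simp
next
  case (Suc m)
  then obtain u w where uw: "a = u + w" "u \<in> cover_exps 1" "w \<in> nfold_sum (cover_exps 1) m"
    by (auto elim: set_plus_elim)
  obtain i where i: "\<And>j. j \<noteq> i \<Longrightarrow> 1 \<le> Poly_Mapping.lookup u j"
  proof (cases "\<exists>i. Poly_Mapping.lookup u i = 0")
    case True
    then obtain i where "Poly_Mapping.lookup u i = 0" by blast
    then have "\<And>j. j \<noteq> i \<Longrightarrow> 1 \<le> Poly_Mapping.lookup u j"
      using uw(2) by (force simp: cover_exps_def)
    then show ?thesis by (rule that)
  next
    case False
    then show ?thesis using that by (metis One_nat_def Suc_leI neq0_conv)
  qed
  have "card (UNIV :: 'v set) - 1 = (\<Sum>v\<in>UNIV - {i}. 1)" by simp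
  also have "\<dots> \<le> (\<Sum>v\<in>UNIV - {i}. Poly_Mapping.lookup u v)"
    using i by (intro sum_mono) auto
  also have "\<dots> \<le> (\<Sum>v\<in>UNIV. Poly_Mapping.lookup u v)"
    by (intro sum_mono2) auto
  finally show ?case
    using Suc.IH[OF uw(3)] by (simp add: uw(1) lookup_add sum.distrib)
qed

text \<open>The hypothesis describes the multiples of \<open>(F/x\<^sub>i)\<^sup>m\<close>, and \<open>F/x\<^sub>i\<close> lies in \<open>I\<close>.\<close>

lemma nfold_cover_sum_if_large_except_one:
  fixes a :: "'v::finite \<Rightarrow>\<^sub>0 nat"
  assumes "\<And>j. j \<noteq> i \<Longrightarrow> m \<le> Poly_Mapping.lookup a j"
  shows "a \<in> nfold_sum (cover_exps 1) m"
  using assms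
proof (induction m arbitrary: a)
  case 0
  then show ?case by simp
next
  case (Suc m)
  define u where "u = expvec (\<lambda>j. if j = i then 0 else 1)"
  have "a = u + (a - u)"
  proof -
    have "Poly_Mapping.lookup u v \<le> Poly_Mapping.lookup a v" for v
      using Suc.prems[of v] by (auto simp: u_def)
    then have "a = (a - u) + u" by (rule le_exponent_imp_add)
    then show ?thesis by (simp only: add.commute)
  qed
  moreover have "u \<in> cover_exps 1" by (auto simp: u_def cover_exps_def)
  moreover have "a - u \<in> nfold_sum (cover_exps 1) m"
  proof (rule Suc.IH)
    fix j assume "j \<noteq> i"
    then show "m \<le> Poly_Mapping.lookup (a - u) j"
      using Suc.prems[of j] by (simp add: u_def lookup_minus)
  qed
  ultimately show ?case by (metis nfold_sum.simps(2) set_plus_intro)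
qed

text \<open>The exponent of \<open>F\<^sup>t (F/x\<^sub>i)\<^sup>m\<^sup>-\<^sup>2\<^sup>t\<close>, provided that \<open>2t \<le> m\<close>.\<close>

definition mixed_exp :: "'v::finite \<Rightarrow> nat \<Rightarrow> nat \<Rightarrow> ('v \<Rightarrow>\<^sub>0 nat)" where
  "mixed_exp i t m = expvec (\<lambda>j. if j = i then t else m - t)"

text \<open>These are the minimal generators of \<open>I\<^sup>(\<^sup>m\<^sup>)\<close> that lie outside \<open>I\<^sup>m\<close> (for \<open>n \<ge> 3\<close>).\<close>

definition extra_gens :: "nat \<Rightarrow> ('v::finite \<Rightarrow>\<^sub>0 nat) set" where
  "extra_gens m = {mixed_exp i t m | i t. 1 \<le> t \<and> 2 * t \<le> m}"

lemma extra_gens_subset_cover_exps: "extra_gens m \<subseteq> cover_exps m"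
  by (auto simp: extra_gens_def mixed_exp_def cover_exps_def)

text \<open>
  The exponent has degree \<open>m(n-1) - t(n-2)\<close>; the hypothesis \<open>n \<ge> 3\<close> makes this drop below \<open>m(n-1)\<close>.
\<close>

lemma extra_gens_disjoint_nfold_sum:
  assumes "card (UNIV :: 'v::finite set) \<ge> 3"
  shows "(extra_gens m :: ('v \<Rightarrow>\<^sub>0 nat) set) \<inter> nfold_sum (cover_exps 1) m = {}"
proof (rule ccontr)
  assume "\<not> ?thesis"
  then obtain i :: 'v and t where t: "1 \<le> t" "2 * t \<le> m"
    and mem: "mixed_exp i t m \<in> nfold_sum (cover_exps 1) m"
    by (auto simp: extra_gens_def)
  obtain q where q: "card (UNIV :: 'v set) = q + 3" using assms by (metis add.commute le_Suc_ex)
  obtain s where s: "m = t + s" "t \<le> s" using that[of "m - t"] t by simp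
  have "(\<Sum>v\<in>UNIV. Poly_Mapping.lookup (mixed_exp i t m) v)
      = t + (\<Sum>v\<in>UNIV - {i}. Poly_Mapping.lookup (mixed_exp i t m) v)"
    by (subst sum.remove[of _ i]) (auto simp: mixed_exp_def)
  also have "(\<Sum>v\<in>UNIV - {i}. Poly_Mapping.lookup (mixed_exp i t m) v) = (\<Sum>v\<in>UNIV - {i}. s)"
    by (rule sum.cong) (auto simp: mixed_exp_def s)
  finally have "m * (card (UNIV :: 'v set) - 1) \<le> t + (q + 2) * s"
    using degree_nfold_cover_sum_ge[OF mem] by (simp add: q)
  then have "t + t * q \<le> 0" by (simp add: q s algebra_simps)
  then show False using t by simp
qed

text \<open>
  For \<open>a\<close> in the symbolic power with smallest entry \<open>a\<^sub>i\<close>, the other entries are at least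
  \<open>m - a\<^sub>i\<close>; truncating \<open>a\<^sub>i\<close> at \<open>m/2\<close> covers the case that all entries exceed \<open>m/2\<close>.
\<close>

lemma cover_exps_covered:
  fixes a :: "'v::finite \<Rightarrow>\<^sub>0 nat"
  assumes a: "a \<in> cover_exps m" and notin: "a \<notin> nfold_sum (cover_exps 1) m"
  shows "\<exists>e. \<exists>b\<in>extra_gens m. a = e + b"
proof -
  have "Min (range (Poly_Mapping.lookup a)) \<in> range (Poly_Mapping.lookup a)"
    by (rule Min_in) auto
  then obtain i where "Poly_Mapping.lookup a i = Min (range (Poly_Mapping.lookup a))"
    by (metis rangeE)
  then have i: "Poly_Mapping.lookup a i \<le> Poly_Mapping.lookup a j" for j
    by simp
  define t where "t = min (Poly_Mapping.lookup a i) (m div 2)"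
  have large: "m - t \<le> Poly_Mapping.lookup a j" if "j \<noteq> i" for j
  proof -
    have "m \<le> Poly_Mapping.lookup a i + Poly_Mapping.lookup a j"
      using a that by (auto simp: cover_exps_def)
    then show ?thesis using i[of j] by (auto simp: t_def min_def)
  qed
  have "t \<noteq> 0"
  proof
    assume "t = 0"
    then have "a \<in> nfold_sum (cover_exps 1) m"
      using large by (intro nfold_cover_sum_if_large_except_one[of i]) simp
    then show False using notin by simp
  qed
  then have "mixed_exp i t m \<in> extra_gens m"
    unfolding extra_gens_def by (intro CollectI exI conjI refl) (auto simp: t_def)
  moreover have "a = (a - mixed_exp i t m) + mixed_exp i t m"
    using large by (intro le_exponent_imp_add) (auto simp: mixed_exp_def t_def)
  ultimately show ?thesis by blast
qed

text \<open>
  Below a vector \<open>(t, m-t, \<dots>, m-t)\<close>, the conditions \<open>a\<^sub>i + a\<^sub>j \<ge> m\<close> for the exceptional \<open>i\<close>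
  are equalities.
\<close>

lemma extra_gens_minimal:
  fixes a e :: "'v::finite \<Rightarrow>\<^sub>0 nat"
  assumes n: "card (UNIV :: 'v set) \<ge> 3"
    and "b \<in> extra_gens m" "a \<in> cover_exps m" "b = e + a"
  shows "e = 0"
proof -
  obtain i t where it: "b = mixed_exp i t m" "2 * t \<le> m"
    using assms(2) by (auto simp: extra_gens_def)
  have sum: "Poly_Mapping.lookup e j + Poly_Mapping.lookup a j = (if j = i then t else m - t)" for j
    using arg_cong[OF assms(4), of "\<lambda>x. Poly_Mapping.lookup x j"]
    by (simp add: it mixed_exp_def lookup_add)
  have zero: "Poly_Mapping.lookup e i = 0 \<and> Poly_Mapping.lookup e j = 0" if "j \<noteq> i" for j
  proof -
    have "m \<le> Poly_Mapping.lookup a i + Poly_Mapping.lookup a j"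
      using assms(3) that by (auto simp: cover_exps_def)
    moreover have "Poly_Mapping.lookup e i + Poly_Mapping.lookup a i
        + (Poly_Mapping.lookup e j + Poly_Mapping.lookup a j) = m"
      using sum[of i] sum[of j] that it(2) by simp
    ultimately show ?thesis by simp
  qed
  have "card {i} < card (UNIV :: 'v set)" using n by simp
  then obtain j where "j \<noteq> i" by (metis (full_types) UNIV_eq_I less_irrefl singletonI)
  then have "Poly_Mapping.lookup e v = 0" for v
    using zero by (cases "v = i") auto
  then show ?thesis by (intro poly_mapping_eqI) simp
qed

lemma extra_gens_eq_image:
  "extra_gens m = (\<lambda>(i, t). mixed_exp i t m) ` (UNIV \<times> {1..m div 2})"
  by (auto simp: extra_gens_def image_iff) (auto intro!: exI)

lemma inj_on_mixed_exp:
  assumes "\<And>t. t \<in> T \<Longrightarrow> 2 * t < m"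
  shows "inj_on (\<lambda>(i, t). mixed_exp i t m) ((UNIV :: 'v::finite set) \<times> T)"
proof (rule inj_onI, clarify)
  fix i i' :: 'v and t t' assume t: "t \<in> T" "t' \<in> T" and eq: "mixed_exp i t m = mixed_exp i' t' m"
  have "t = (if i = i' then t' else m - t')"
    using arg_cong[OF eq, of "\<lambda>x. Poly_Mapping.lookup x i"] by (simp add: mixed_exp_def)
  then show "i = i' \<and> t = t'"
    using assms[OF t(1)] assms[OF t(2)] by (auto split: if_splits)
qed

lemma card_extra_gens_odd:
  "card (extra_gens (2 * k + 1) :: ('v::finite \<Rightarrow>\<^sub>0 nat) set) = card (UNIV :: 'v set) * k"
  unfolding extra_gens_eq_image
  by (subst card_image, rule inj_on_mixed_exp) (auto simp: card_cartesian_product)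

lemma card_extra_gens_even:
  "card (extra_gens (2 * k + 2) :: ('v::finite \<Rightarrow>\<^sub>0 nat) set) = card (UNIV :: 'v set) * k + 1"
proof -
  let ?f = "\<lambda>(i::'v, t). mixed_exp i t (2 * k + 2)"
  define mid :: "'v \<Rightarrow>\<^sub>0 nat" where "mid = expvec (\<lambda>_. k + 1)"
  have const: "mixed_exp i (k + 1) (2 * k + 2) = mid" for i :: 'v
    by (rule poly_mapping_eqI) (simp add: mixed_exp_def mid_def)
  have "UNIV \<times> {1..k + 1} = (UNIV :: 'v set) \<times> {1..k} \<union> UNIV \<times> {k + 1}" by auto
  then have "extra_gens (2 * k + 2) = ?f ` (UNIV \<times> {1..k}) \<union> ?f ` (UNIV \<times> {k + 1})"
    by (simp add: extra_gens_eq_image image_Un)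
  also have "?f ` (UNIV \<times> {k + 1}) = {mid}"
    using const by (auto simp: image_iff)
  finally have "extra_gens (2 * k + 2) = insert mid (?f ` (UNIV \<times> {1..k}))" by simp
  moreover have "mid \<notin> ?f ` (UNIV \<times> {1..k})"
  proof
    assume "mid \<in> ?f ` (UNIV \<times> {1..k})"
    then obtain i :: 'v and t where t: "t \<le> k" "mid = mixed_exp i t (2 * k + 2)" by auto
    have "k + 1 = t"
      using arg_cong[OF t(2), of "\<lambda>x. Poly_Mapping.lookup x i"]
      by (simp add: mixed_exp_def mid_def)
    then show False using t by simp
  qed
  moreover have "card (?f ` (UNIV \<times> {1..k})) = card (UNIV :: 'v set) * k"
    by (subst card_image, rule inj_on_mixed_exp) (auto simp: card_cartesian_product)
  ultimately show ?thesis by simp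
qed


section \<open>The symbolic defect\<close>

lemma sdefect_complete_graph:
  assumes "card (UNIV :: 'v::finite set) \<ge> 3"
  shows "sdefect_cover_ideal TYPE('k::field) (complete_graph :: 'v set set) m
    = card (extra_gens m :: ('v \<Rightarrow>\<^sub>0 nat) set)"
proof -
  have "ideal_pow (cover_ideal complete_graph :: ('v, 'k) mpoly set) m
      = monom_ideal (nfold_sum (cover_exps 1) m)"
    by (simp add: cover_ideal_complete_graph ideal_pow_monom_ideal up_closed_cover_exps)
  moreover have "min_gens_quotient (monom_ideal (cover_exps m) :: ('v, 'k) mpoly set)
      (monom_ideal (nfold_sum (cover_exps 1) m)) = card (extra_gens m :: ('v \<Rightarrow>\<^sub>0 nat) set)"
  proof (rule min_gens_quotient_monom_ideal)
    show "finite (extra_gens m :: ('v \<Rightarrow>\<^sub>0 nat) set)" by (simp add: extra_gens_eq_image)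
    show "extra_gens m \<inter> nfold_sum (cover_exps 1) m = ({} :: ('v \<Rightarrow>\<^sub>0 nat) set)"
      by (rule extra_gens_disjoint_nfold_sum[OF assms])
    show "e = 0" if "b \<in> extra_gens m" "a \<in> cover_exps m" "b = e + a"
      for b e a :: "'v \<Rightarrow>\<^sub>0 nat"
      using extra_gens_minimal[OF assms that] .
  qed (simp_all add: up_closed_cover_exps up_closed_nfold_sum extra_gens_subset_cover_exps
      cover_exps_covered)
  ultimately show ?thesis
    by (simp add: sdefect_cover_ideal_def cover_ideal_sympow_complete_graph)
qed

lemma linear_quasi_polynomial_if_parity:
  fixes n :: nat
  assumes "n > 0"
    and even: "\<And>k. f (2 * k + 2) = n * k + 1" and odd: "\<And>k. f (2 * k + 1) = n * k"
  shows "linear_quasi_polynomial f"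
proof -
  let ?n = "of_nat n :: rat"
  \<comment> \<open>Substituting \<open>k = (m - 2)/2\<close> and \<open>k = (m - 1)/2\<close>: the polynomials \<open>n(m-2)/2 + 1\<close> and \<open>n(m-1)/2\<close>.\<close>
  define p where "p = (\<lambda>r::nat. if r = 0 then [:1 - ?n, ?n / 2:] else [:- ?n / 2, ?n / 2:])"
  have "of_nat (f m) = poly (p (m mod 2)) (of_nat m)" if "m \<ge> 1" for m
  proof (cases "m mod 2 = 0")
    case True
    then have "m = 2 * (m div 2 - 1) + 2" using \<open>m \<ge> 1\<close> by presburger
    then obtain k where m: "m = 2 * k + 2" by blast
    have "poly (p 0) (2 * of_nat k + 2) = ?n * of_nat k + 1"
      by (simp add: p_def field_simps)
    moreover have "f m = n * k + 1" unfolding m by (rule even)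
    moreover have "(of_nat m :: rat) = 2 * of_nat k + 2" by (simp add: m)
    ultimately show ?thesis by (simp only: True of_nat_add of_nat_mult of_nat_1)
  next
    case False
    then have "m = 2 * (m div 2) + 1" by presburger
    then obtain k where m: "m = 2 * k + 1" by blast
    have "poly (p 1) (2 * of_nat k + 1) = ?n * of_nat k"
      by (simp add: p_def field_simps)
    moreover have "f m = n * k" unfolding m by (rule odd)
    moreover have "(of_nat m :: rat) = 2 * of_nat k + 1" by (simp add: m)
    moreover have "m mod 2 = 1" using False by simp
    ultimately show ?thesis by (simp only: of_nat_mult)
  qed
  then have "has_constituents f 2 p" by (simp add: has_constituents_def)
  moreover have "(\<lambda>r. degree (p r)) ` {..<2} = {1}"
  proof -
    have "{..<2::nat} = {0, 1}" by auto
    then show ?thesis using \<open>n > 0\<close> by (simp add: p_def)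
  qed
  ultimately show ?thesis unfolding linear_quasi_polynomial_def by (metis Max_singleton)
qed

theorem theorem5p7:
  fixes n :: nat
  assumes "card (UNIV :: 'v::finite set) = n" and "n \<ge> 3"
  shows "(\<forall>m k :: nat.
            (m = 2 * k + 2 \<longrightarrow>
               sdefect_cover_ideal TYPE('k::field) (complete_graph :: 'v set set) m = n * k + 1) \<and>
            (m = 2 * k + 1 \<longrightarrow>
               sdefect_cover_ideal TYPE('k) (complete_graph :: 'v set set) m = n * k)) \<and>
         linear_quasi_polynomial
           (\<lambda>m. sdefect_cover_ideal TYPE('k) (complete_graph :: 'v set set) m)"
proof -
  let ?s = "\<lambda>m. sdefect_cover_ideal TYPE('k) (complete_graph :: 'v set set) m"
  have n: "card (UNIV :: 'v set) \<ge> 3" using assms by simp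
  have even: "?s (2 * k + 2) = n * k + 1" for k
    unfolding sdefect_complete_graph[OF n] card_extra_gens_even assms(1) ..
  have odd: "?s (2 * k + 1) = n * k" for k
    unfolding sdefect_complete_graph[OF n] card_extra_gens_odd assms(1) ..
  have "linear_quasi_polynomial ?s"
    using assms(2) even odd by (intro linear_quasi_polynomial_if_parity[of n]) auto
  then show ?thesis using even odd by blast
qed

end
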